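(* Let $f:X\to Y$ be a smooth map between diffeological spaces. By "data" we mean a point $x\in X$, a plot $P:U\to Y$ and a point $r\in U$ with $P(r)=f(x)$. By a "local lift" for such data we mean a plot $L:V\to X$ defined on an open neighborhood $V\subseteq U$ of $r$ such that $f\circ L=P|_V$ and $L(r)=x$; two local lifts are regarded as equal if they have the same germ at $r$, i.e. agree on some open neighborhood of $r$. (S) $f$ is a diffeological submersion if and only if for any data there exists at least one local lift. (I) If $f$ is a diffeological immersion, then for any data there exists at most one local lift (up to germs at $r$). (E) $f$ is a diffeological étale map if and only if for any data there exists a local lift and it is unique (up to germs at $r$).
   Context: An $n$-domain is an open subset of $\mathbb{R}^n$; a domain is an $n$-domain for some $n\ge 0$. A parametrization in a set $X$ is a map from a domain to $X$. A diffeology on $X$ is a set $\mathcal{D}$ of parametrizations in $X$ such that: (D1) the images of the elements of $\mathcal{D}$ cover $X$; (D2) $P\circ F\in\mathcal{D}$ for every $P:U\to X$ in $\mathcal{D}$ and every smooth map $F:V\to U$ between domains; (D3) if a family of $n$-parametrizations $P_i:U_i\to X$ in $\mathcal{D}$ agree on overlaps, their common extension to $\bigcup_i U_i$ is in $\mathcal{D}$. A diffeological space is a set with a diffeology, whose elements are called plots. A map $f:X\to Y$ is smooth if $f\circ P$ is a plot in $Y$ for every plot $P$ in $X$; a diffeomorphism is a smooth bijection with smooth inverse. A subset of $X$ is D-open if its preimage under every plot is open; this defines the D-topology. Subsets carry the subspace diffeology (plots with values in the subset), and the plots of a product are the tuples of plots. Domains carry their usual smooth parametrizations as plots. For smooth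 maps $f:X\to Y$ and $g:Z\to Y$, the pullback of $f$ by $g$ is $g^*f:g^*X\to Z$, $(z,x)\mapsto z$, where $g^*X=\{(z,x)\in Z\times X: g(z)=f(x)\}$. Submersion: a smooth map $f:X\to Y$ such that for each $x_0\in X$ there are a D-open $O\subseteq Y$ and a smooth map $\sigma:O\to X$ with $f\circ\sigma(y)=y$ for all $y\in O$ and $x_0\in\sigma(O)$. Diffeological submersion: a smooth map $f:X\to Y$ whose pullback $P^*f$ by every plot $P$ in $Y$ is a submersion. Diffeological immersion: a smooth map $f:X\to Y$ such that for every plot $P:U\to Y$ and every $(r_0,x_0)\in P^*X$ there exist a D-open neighborhood $O$ of $(r_0,x_0)$ in $P^*X$, an open neighborhood $V\subseteq U$ of $P^*f(O)$ and a smooth map $\varrho:V\to U\times X$ such that $\varrho\circ P^*f(r,x)=(r,x)$ for all $(r,x)\in O$. Étale map: a map $f:X\to Y$ such that every $x_0\in X$ has a D-open neighborhood $O\subseteq X$, and $f(x_0)$ a D-open neighborhood $O'\subseteq Y$, with $f|_O:O\to O'$ a diffeomorphism. Diffeological étale map: a smooth map whose pullback by every plot in the target is étale. *)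

theory Defs
  imports "HOL-Analysis.Analysis"
begin

text \<open>
  The space \<open>\<real>\<^sup>n\<close>, for \<open>n \<ge> 0\<close> a number that may vary inside a statement, is
  \<^const>\<open>Euclidean_space\<close>, whose points are the functions \<open>x :: nat \<Rightarrow> real\<close> with \<open>x i = 0\<close>
  for \<open>i \<ge> n\<close>.  An \<open>n\<close>-domain is a set \<open>U\<close> with \<open>openin (Euclidean_space n) U\<close>.
\<close>

type_synonym vec = "nat \<Rightarrow> real"

text \<open>
  \<open>C_k k n U f\<close>: all iterated partial derivatives of \<open>f : U \<rightarrow> \<real>\<close> of order at most \<open>k\<close> exist
  and are continuous on the \<open>n\<close>-domain \<open>U\<close>.  In the recursive clause \<open>g\<close> is the \<open>i\<close>-th partial
  derivative of \<open>f\<close>, so it is determined on \<open>U\<close>.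
\<close>

primrec C_k :: "nat \<Rightarrow> nat \<Rightarrow> vec set \<Rightarrow> (vec \<Rightarrow> real) \<Rightarrow> bool" where
  "C_k 0 n U f \<longleftrightarrow> continuous_map (subtopology (Euclidean_space n) U) euclideanreal f"
| "C_k (Suc k) n U f \<longleftrightarrow>
     continuous_map (subtopology (Euclidean_space n) U) euclideanreal f \<and>
     (\<forall>i<n. \<exists>g. (\<forall>x\<in>U. ((\<lambda>t. f (x(i := t))) has_real_derivative g x) (at (x i))) \<and>
                C_k k n U g)"

definition smooth_between :: "nat \<Rightarrow> vec set \<Rightarrow> nat \<Rightarrow> vec set \<Rightarrow> (vec \<Rightarrow> vec) \<Rightarrow> bool" where
  "smooth_between m V n U F \<longleftrightarrow> F \<in> V \<rightarrow> U \<and> (\<forall>j<n. \<forall>k. C_k k m V (\<lambda>x. F x j))"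

text \<open>
  \<open>plots X n U\<close> is the set of those elements of the diffeology that are defined on the
  \<open>n\<close>-domain \<open>U\<close>.  Parametrizations are extensional functions (\<^const>\<open>undefined\<close> outside \<open>U\<close>),
  so that equality of parametrizations on \<open>U\<close> is equality of functions; composites are
  accordingly formed with \<^const>\<open>compose\<close>.
\<close>

record 'a diff_space =
  points :: "'a set"
  plots :: "nat \<Rightarrow> vec set \<Rightarrow> (vec \<Rightarrow> 'a) set"

text \<open>
  In the last clause a family of \<open>n\<close>-parametrizations is a set \<open>\<F>\<close> of pairs
  (domain, parametrization), and \<open>Q\<close> is its common extension.
\<close>

definition diffeological_space :: "'a diff_space \<Rightarrow> bool" where
  "diffeological_space X \<longleftrightarrow>
     (\<forall>n U P. P \<in> plots X n U \<longrightarrow> openin (Euclidean_space n) U \<and> P \<in> U \<rightarrow>\<^sub>E points X) \<and>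
     (\<forall>x\<in>points X. \<exists>n U P. P \<in> plots X n U \<and> x \<in> P ` U) \<and>
     (\<forall>n U P m V F. P \<in> plots X n U \<and> openin (Euclidean_space m) V \<and> smooth_between m V n U F
        \<longrightarrow> compose V P F \<in> plots X m V) \<and>
     (\<forall>n \<F>. (\<forall>(U, P)\<in>\<F>. P \<in> plots X n U) \<and>
             (\<forall>(U, P)\<in>\<F>. \<forall>(V, P')\<in>\<F>. \<forall>u\<in>U \<inter> V. P u = P' u) \<longrightarrow>
        (\<forall>Q \<in> extensional (\<Union>(U, P)\<in>\<F>. U). (\<forall>(U, P)\<in>\<F>. \<forall>u\<in>U. Q u = P u)
           \<longrightarrow> Q \<in> plots X n (\<Union>(U, P)\<in>\<F>. U)))"

definition smooth_map :: "'a diff_space \<Rightarrow> 'b diff_space \<Rightarrow> ('a \<Rightarrow> 'b) \<Rightarrow> bool" where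
  "smooth_map X Y f \<longleftrightarrow> f \<in> points X \<rightarrow> points Y \<and>
     (\<forall>n U. \<forall>P\<in>plots X n U. compose U f P \<in> plots Y n U)"

definition diffeomorphism :: "'a diff_space \<Rightarrow> 'b diff_space \<Rightarrow> ('a \<Rightarrow> 'b) \<Rightarrow> bool" where
  "diffeomorphism X Y f \<longleftrightarrow> bij_betw f (points X) (points Y) \<and>
     smooth_map X Y f \<and> smooth_map Y X (inv_into (points X) f)"

definition D_topology :: "'a diff_space \<Rightarrow> 'a topology" where
  "D_topology X = topology (\<lambda>A. A \<subseteq> points X \<and>
     (\<forall>n U. \<forall>P\<in>plots X n U. openin (Euclidean_space n) {u \<in> U. P u \<in> A}))"

lemma openin_D_topology:
  "openin (D_topology X) A \<longleftrightarrow> A \<subseteq> points X \<and>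
     (\<forall>n U. \<forall>P\<in>plots X n U. openin (Euclidean_space n) {u \<in> U. P u \<in> A})"
proof -
  have "istopology (\<lambda>A. A \<subseteq> points X \<and>
     (\<forall>n U. \<forall>P\<in>plots X n U. openin (Euclidean_space n) {u \<in> U. P u \<in> A}))"
    unfolding istopology_def
  proof (intro conjI allI impI ballI)
    fix S T n U P
    assume S: "S \<subseteq> points X \<and>
        (\<forall>n U. \<forall>P\<in>plots X n U. openin (Euclidean_space n) {u \<in> U. P u \<in> S})"
      and T: "T \<subseteq> points X \<and>
        (\<forall>n U. \<forall>P\<in>plots X n U. openin (Euclidean_space n) {u \<in> U. P u \<in> T})"
    show "S \<inter> T \<subseteq> points X" using S by blast
    assume "P \<in> plots X n U"
    then have "openin (Euclidean_space n) ({u \<in> U. P u \<in> S} \<inter> {u \<in> U. P u \<in> T})"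
      using S T by blast
    also have "{u \<in> U. P u \<in> S} \<inter> {u \<in> U. P u \<in> T} = {u \<in> U. P u \<in> S \<inter> T}" by blast
    finally show "openin (Euclidean_space n) {u \<in> U. P u \<in> S \<inter> T}" .
  next
    fix \<K> n U P
    assume K: "\<forall>K\<in>\<K>. K \<subseteq> points X \<and>
        (\<forall>n U. \<forall>P\<in>plots X n U. openin (Euclidean_space n) {u \<in> U. P u \<in> K})"
    show "\<Union>\<K> \<subseteq> points X" using K by blast
    assume "P \<in> plots X n U"
    then have "openin (Euclidean_space n) (\<Union>K\<in>\<K>. {u \<in> U. P u \<in> K})"
      using K by blast
    also have "(\<Union>K\<in>\<K>. {u \<in> U. P u \<in> K}) = {u \<in> U. P u \<in> \<Union>\<K>}" by blast
    finally show "openin (Euclidean_space n) {u \<in> U. P u \<in> \<Union>\<K>}" .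
  qed
  then show ?thesis
    unfolding D_topology_def by (simp add: topology_inverse')
qed

definition domain_space :: "nat \<Rightarrow> vec set \<Rightarrow> vec diff_space" where
  "domain_space n U = \<lparr>points = U,
     plots = \<lambda>m V. {F. openin (Euclidean_space m) V \<and> F \<in> extensional V \<and> smooth_between m V n U F}\<rparr>"

definition subspace_diff :: "'a diff_space \<Rightarrow> 'a set \<Rightarrow> 'a diff_space" where
  "subspace_diff X A = \<lparr>points = points X \<inter> A, plots = \<lambda>n U. {P \<in> plots X n U. P ` U \<subseteq> A}\<rparr>"

definition prod_diff :: "'a diff_space \<Rightarrow> 'b diff_space \<Rightarrow> ('a \<times> 'b) diff_space" where
  "prod_diff X Y = \<lparr>points = points X \<times> points Y,
     plots = \<lambda>n U. {P \<in> extensional U. compose U fst P \<in> plots X n U \<and> compose U snd P \<in> plots Y n U}\<rparr>"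

text \<open>
  \<open>pullback_space Z g X f\<close> is \<open>g\<^sup>*X\<close>; the pullback \<open>g\<^sup>*f\<close> itself is the map
  \<open>fst : g\<^sup>*X \<rightarrow> Z\<close>.
\<close>

definition pullback_space ::
  "'c diff_space \<Rightarrow> ('c \<Rightarrow> 'b) \<Rightarrow> 'a diff_space \<Rightarrow> ('a \<Rightarrow> 'b) \<Rightarrow> ('c \<times> 'a) diff_space" where
  "pullback_space Z g X f =
     subspace_diff (prod_diff Z X) {(z, x). z \<in> points Z \<and> x \<in> points X \<and> g z = f x}"

definition submersion :: "'a diff_space \<Rightarrow> 'b diff_space \<Rightarrow> ('a \<Rightarrow> 'b) \<Rightarrow> bool" where
  "submersion X Y f \<longleftrightarrow> smooth_map X Y f \<and>
     (\<forall>x\<^sub>0\<in>points X. \<exists>A \<sigma>. openin (D_topology Y) A \<and> smooth_map (subspace_diff Y A) X \<sigma> \<and>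
        (\<forall>y\<in>A. f (\<sigma> y) = y) \<and> x\<^sub>0 \<in> \<sigma> ` A)"

definition diffeological_submersion :: "'a diff_space \<Rightarrow> 'b diff_space \<Rightarrow> ('a \<Rightarrow> 'b) \<Rightarrow> bool" where
  "diffeological_submersion X Y f \<longleftrightarrow> smooth_map X Y f \<and>
     (\<forall>n U. \<forall>P\<in>plots Y n U.
        submersion (pullback_space (domain_space n U) P X f) (domain_space n U) fst)"

definition diffeological_immersion :: "'a diff_space \<Rightarrow> 'b diff_space \<Rightarrow> ('a \<Rightarrow> 'b) \<Rightarrow> bool" where
  "diffeological_immersion X Y f \<longleftrightarrow> smooth_map X Y f \<and>
     (\<forall>n U. \<forall>P\<in>plots Y n U. \<forall>p\<^sub>0\<in>points (pullback_space (domain_space n U) P X f).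
        \<exists>A V \<rho>. openin (D_topology (pullback_space (domain_space n U) P X f)) A \<and> p\<^sub>0 \<in> A \<and>
          openin (Euclidean_space n) V \<and> fst ` A \<subseteq> V \<and> V \<subseteq> U \<and>
          smooth_map (domain_space n V) (prod_diff (domain_space n U) X) \<rho> \<and>
          (\<forall>p\<in>A. \<rho> (fst p) = p))"

definition etale :: "'a diff_space \<Rightarrow> 'b diff_space \<Rightarrow> ('a \<Rightarrow> 'b) \<Rightarrow> bool" where
  "etale X Y f \<longleftrightarrow> f \<in> points X \<rightarrow> points Y \<and>
     (\<forall>x\<^sub>0\<in>points X. \<exists>A B. openin (D_topology X) A \<and> x\<^sub>0 \<in> A \<and>
        openin (D_topology Y) B \<and> f x\<^sub>0 \<in> B \<and>
        diffeomorphism (subspace_diff X A) (subspace_diff Y B) f)"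

definition diffeological_etale :: "'a diff_space \<Rightarrow> 'b diff_space \<Rightarrow> ('a \<Rightarrow> 'b) \<Rightarrow> bool" where
  "diffeological_etale X Y f \<longleftrightarrow> smooth_map X Y f \<and>
     (\<forall>n U. \<forall>P\<in>plots Y n U.
        etale (pullback_space (domain_space n U) P X f) (domain_space n U) fst)"

definition lift_data ::
  "'a diff_space \<Rightarrow> 'b diff_space \<Rightarrow> ('a \<Rightarrow> 'b) \<Rightarrow> 'a \<Rightarrow> nat \<Rightarrow> vec set \<Rightarrow> (vec \<Rightarrow> 'b) \<Rightarrow> vec \<Rightarrow> bool"
  where
  "lift_data X Y f x n U P r \<longleftrightarrow> x \<in> points X \<and> P \<in> plots Y n U \<and> r \<in> U \<and> P r = f x"

definition local_lift ::
  "'a diff_space \<Rightarrow> ('a \<Rightarrow> 'b) \<Rightarrow> 'a \<Rightarrow> nat \<Rightarrow> vec set \<Rightarrow> (vec \<Rightarrow> 'b) \<Rightarrow> vec \<Rightarrow>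
   vec set \<Rightarrow> (vec \<Rightarrow> 'a) \<Rightarrow> bool" where
  "local_lift X f x n U P r V L \<longleftrightarrow>
     openin (Euclidean_space n) V \<and> r \<in> V \<and> V \<subseteq> U \<and>
     L \<in> plots X n V \<and> (\<forall>v\<in>V. f (L v) = P v) \<and> L r = x"

definition same_germ ::
  "nat \<Rightarrow> vec \<Rightarrow> vec set \<Rightarrow> (vec \<Rightarrow> 'a) \<Rightarrow> vec set \<Rightarrow> (vec \<Rightarrow> 'a) \<Rightarrow> bool" where
  "same_germ n r V L V' L' \<longleftrightarrow>
     (\<exists>W. openin (Euclidean_space n) W \<and> r \<in> W \<and> W \<subseteq> V \<inter> V' \<and> (\<forall>w\<in>W. L w = L' w))"

end

theory Submission
  imports Defs
begin

text \<open>
  A local lift \<open>L\<close> of a plot \<open>P\<close> is the same thing as a smooth local section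
  \<open>v \<mapsto> (v, L v)\<close> of \<open>P\<^sup>*f : P\<^sup>*X \<rightarrow> U\<close>, which gives (S).  If \<open>P\<^sup>*f\<close> is injective on a D-open
  neighbourhood of \<open>(r, x)\<close>, then any two such sections through \<open>(r, x)\<close> agree near \<open>r\<close>, which
  gives (I) and the uniqueness in (E).  Conversely, if local lifts are unique, the image of a
  section \<open>v \<mapsto> (v, L v)\<close> is D-open: where a plot \<open>(F, G)\<close> of \<open>P\<^sup>*X\<close> meets it, both \<open>G\<close> and
  \<open>L \<circ> F\<close> lift the plot \<open>P \<circ> F\<close>, so they agree nearby.
\<close>

section \<open>Calculus of \<open>C_k\<close> functions on Euclidean domains\<close>

text \<open>Varying a coordinate with index below \<open>n\<close> keeps the point in \<real>^n.
  This makes the trace of an open set on a coordinate line open in \<real>.\<close>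

lemma continuous_map_fun_upd_Euclidean_space:
  assumes "x \<in> topspace (Euclidean_space n)" "i < n"
  shows "continuous_map euclideanreal (Euclidean_space n) (\<lambda>t. x(i := t))"
  using assms
  by (auto simp: Euclidean_space_def continuous_map_in_subtopology continuous_map_componentwise_UNIV
      topspace_Euclidean_space fun_upd_def split: if_splits)

text \<open>A partial derivative at a point of the open set \<open>U\<close> only sees values on a
  short piece of a coordinate line, which stays inside \<open>U\<close>. The derivative functions of
  \<open>f\<close> therefore serve for \<open>g\<close> as well, and a case split on
  \<open>k\<close> replaces an induction. The lemma is used to pass between a map and its
  extensional restriction.\<close>

lemma C_k_cong:
  assumes U: "openin (Euclidean_space n) U" and eq: "\<And>x. x \<in> U \<Longrightarrow> f x = g x" and f: "C_k k n U f"
  shows "C_k k n U g"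
proof -
  have cont: "continuous_map (subtopology (Euclidean_space n) U) euclideanreal g"
    if "continuous_map (subtopology (Euclidean_space n) U) euclideanreal f"
    using that by (rule continuous_map_eq) (auto simp: eq)
  show ?thesis
  proof (cases k)
    case 0
    then show ?thesis using f cont by simp
  next
    case (Suc l)
    have "((\<lambda>t. g (x(i := t))) has_real_derivative d) (at (x i))"
      if x: "x \<in> U" and "i < n" and d: "((\<lambda>t. f (x(i := t))) has_real_derivative d) (at (x i))"
      for x i d
    proof -
      have "x \<in> topspace (Euclidean_space n)"
        using U x openin_subset by blast
      then have "open {t. x(i := t) \<in> U}"
        using openin_continuous_map_preimage[OF continuous_map_fun_upd_Euclidean_space U] \<open>i < n\<close>
        by fastforce
      then have "\<forall>\<^sub>F t in nhds (x i). x(i := t) \<in> U"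
        by (rule eventually_nhds_in_open[where s="{t. x(i := t) \<in> U}", simplified]) (simp add: x)
      then have "\<forall>\<^sub>F t in nhds (x i). f (x(i := t)) = g (x(i := t))"
        by eventually_elim (rule eq)
      from DERIV_cong_ev[OF refl this refl] d show ?thesis
        by blast
    qed
    then have "\<forall>i<n. \<exists>h. (\<forall>x\<in>U. ((\<lambda>t. g (x(i := t))) has_real_derivative h x) (at (x i)))
        \<and> C_k l n U h"
      using f unfolding Suc C_k.simps by meson
    then show ?thesis using f cont unfolding Suc C_k.simps by simp
  qed
qed

lemma C_k_mono: "C_k k n U f \<Longrightarrow> V \<subseteq> U \<Longrightarrow> C_k k n V f"
proof (induction k arbitrary: f)
  case 0
  then show ?case
    using continuous_map_from_subtopology_mono by auto
next
  case (Suc k)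
  then show ?case
    using continuous_map_from_subtopology_mono unfolding C_k.simps by (meson subsetD)
qed

lemma C_k_const: "C_k k n U (\<lambda>x. c)"
proof (induction k arbitrary: c)
  case (Suc k)
  have "\<exists>g. (\<forall>x\<in>U. ((\<lambda>t. c) has_real_derivative g x) (at (x i))) \<and> C_k k n U g" for i
    using Suc[of 0] by (intro exI[of _ "\<lambda>x. 0"]) auto
  then show ?case by simp
qed simp

text \<open>The partial derivatives are constantly 0 or 1, so everything beyond the first order is
  covered by \<open>C_k_const\<close>.\<close>

lemma C_k_coordinate: "C_k k n U (\<lambda>x. x j)"
proof -
  have cont: "continuous_map (subtopology (Euclidean_space n) U) euclideanreal (\<lambda>x. x j)"
    unfolding Euclidean_space_def
    by (intro continuous_map_from_subtopology continuous_map_product_projection) simp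
  show ?thesis
  proof (cases k)
    case 0
    then show ?thesis using cont by simp
  next
    case (Suc l)
    have "\<exists>g. (\<forall>x\<in>U. ((\<lambda>t. (x(i := t)) j) has_real_derivative g x) (at (x i))) \<and> C_k l n U g" for i
      by (intro exI[of _ "\<lambda>x. if i = j then 1 else 0"]) (auto simp: C_k_const)
    then show ?thesis using cont Suc by simp
  qed
qed

section \<open>Plots of domains and of pullbacks, and the D-topology of a domain\<close>

text \<open>The inclusion of an open subset, made extensional, is the test plot to which a smooth
  map on a domain is applied in order to become a plot itself.\<close>

lemma restrict_id_in_plots_domain_space:
  assumes "openin (Euclidean_space n) V" "V \<subseteq> U"
  shows "restrict (\<lambda>v. v) V \<in> plots (domain_space n U) n V"
proof -
  have "C_k k n V (\<lambda>x. restrict (\<lambda>v. v) V x j)" for k j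
    by (rule C_k_cong[OF assms(1) _ C_k_coordinate[of _ _ _ j]]) simp
  then show ?thesis
    using assms by (auto simp: domain_space_def smooth_between_def)
qed

lemma restrict_in_plots_domain_space:
  assumes F: "F \<in> plots (domain_space n U) m W"
    and V: "openin (Euclidean_space m) V" and "V \<subseteq> W"
  shows "restrict F V \<in> plots (domain_space n U) m V"
proof -
  have "C_k k m V (\<lambda>x. restrict F V x j)" if "j < n" for j k
  proof (rule C_k_cong[OF V])
    show "C_k k m V (\<lambda>x. F x j)"
      using F that C_k_mono[OF _ \<open>V \<subseteq> W\<close>] by (simp add: domain_space_def smooth_between_def)
  qed simp
  then show ?thesis
    using assms by (auto simp: domain_space_def smooth_between_def)
qed

lemma points_domain_space [simp]: "points (domain_space n U) = U"
  by (simp add: domain_space_def)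

lemma points_subspace_diff [simp]: "points (subspace_diff X A) = points X \<inter> A"
  by (simp add: subspace_diff_def)

lemma plots_subspace_diff [simp]:
  "plots (subspace_diff X A) n U = {P \<in> plots X n U. P ` U \<subseteq> A}"
  by (simp add: subspace_diff_def)

lemma points_pullback_space:
  "points (pullback_space Z g X f) = {(z, x). z \<in> points Z \<and> x \<in> points X \<and> g z = f x}"
  by (auto simp: pullback_space_def prod_diff_def)

lemma plots_pullback_space:
  "Q \<in> plots (pullback_space Z g X f) n U \<longleftrightarrow>
     Q \<in> extensional U \<and> compose U fst Q \<in> plots Z n U \<and> compose U snd Q \<in> plots X n U \<and>
     Q ` U \<subseteq> points (pullback_space Z g X f)"
  by (auto simp: pullback_space_def prod_diff_def)

lemma smooth_map_fst_pullback_space: "smooth_map (pullback_space Z g X f) Z fst"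
  by (auto simp: smooth_map_def plots_pullback_space points_pullback_space)

lemma
  assumes "diffeological_space X" "P \<in> plots X n U"
  shows plot_openin: "openin (Euclidean_space n) U"
    and plot_PiE: "P \<in> U \<rightarrow>\<^sub>E points X"
  using conjunct1[OF assms(1)[unfolded diffeological_space_def]] assms(2) by simp_all

text \<open>This is axiom (D2), with the smooth map between domains regarded as a plot of its
  target.\<close>

lemma plot_compose:
  assumes X: "diffeological_space X" and P: "P \<in> plots X n U"
    and F: "F \<in> plots (domain_space n U) m V"
  shows "compose V P F \<in> plots X m V"
  using conjunct1[OF conjunct2[OF conjunct2[OF X[unfolded diffeological_space_def]]]] P F
  unfolding domain_space_def by fastforce

lemma plots_domain_space_mono:
  assumes "F \<in> plots (domain_space n U) m W" "F ` W \<subseteq> V"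
  shows "F \<in> plots (domain_space n V) m W"
  using assms by (auto simp: domain_space_def smooth_between_def)

text \<open>\<open>smooth_between\<close> controls only the coordinates below \<open>n\<close>,
  whose continuity is the case \<open>C_k 0\<close>. The remaining ones vanish because the values
  lie in \<open>U\<close>, a subset of \<real>^n.\<close>

lemma continuous_map_plot_domain_space:
  assumes F: "F \<in> plots (domain_space n U) m W" and U: "openin (Euclidean_space n) U"
  shows "continuous_map (subtopology (Euclidean_space m) W) (Euclidean_space n) F"
proof -
  have sub: "U \<subseteq> topspace (Euclidean_space n)"
    using U openin_subset by blast
  have W: "W \<subseteq> topspace (Euclidean_space m)"
    using F openin_subset by (auto simp: domain_space_def)
  have FU: "F w \<in> U" if "w \<in> W" for w
    using F that by (auto simp: domain_space_def smooth_between_def)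
  have F0: "F w j = 0" if "w \<in> W" "j \<ge> n" for w j
    using FU[OF that(1)] sub that(2) by (auto simp: topspace_Euclidean_space)
  have "continuous_map (subtopology (Euclidean_space m) W) euclideanreal (\<lambda>w. F w j)" for j
  proof (cases "j < n")
    case True
    then have "C_k 0 m W (\<lambda>w. F w j)"
      using F by (simp del: C_k.simps add: domain_space_def smooth_between_def)
    then show ?thesis by simp
  next
    case False
    have "continuous_map (subtopology (Euclidean_space m) W) euclideanreal (\<lambda>w. 0)"
      by simp
    then show ?thesis
      by (rule continuous_map_eq) (use False F0 in auto)
  qed
  then show ?thesis
    unfolding Euclidean_space_def[of n]
    using F0 by (auto simp: continuous_map_in_subtopology continuous_map_componentwise_UNIV)
qed

lemma openin_plot_domain_space_preimage:
  assumes F: "F \<in> plots (domain_space n U) m W" and U: "openin (Euclidean_space n) U"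
    and A: "openin (Euclidean_space n) A"
  shows "openin (Euclidean_space m) {w \<in> W. F w \<in> A}"
proof -
  have W: "openin (Euclidean_space m) W"
    using F by (simp add: domain_space_def)
  have "openin (subtopology (Euclidean_space m) W) {w \<in> topspace (subtopology (Euclidean_space m) W). F w \<in> A}"
    by (rule openin_continuous_map_preimage[OF continuous_map_plot_domain_space[OF F U] A])
  moreover have "topspace (subtopology (Euclidean_space m) W) = W"
    using openin_subset[OF W] by auto
  ultimately show ?thesis
    using openin_open_subtopology[OF W] by (simp del: topspace_subtopology)
qed

text \<open>Testing with the identity plot of \<open>U\<close> shows that D-open sets are open;
  continuity of all plots gives the converse.\<close>

lemma openin_D_topology_domain_space:
  assumes U: "openin (Euclidean_space n) U"
  shows "openin (D_topology (domain_space n U)) A \<longleftrightarrow> A \<subseteq> U \<and> openin (Euclidean_space n) A"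
proof
  assume A: "openin (D_topology (domain_space n U)) A"
  then have "openin (Euclidean_space n) {u \<in> U. restrict (\<lambda>v. v) U u \<in> A}" and "A \<subseteq> U"
    using restrict_id_in_plots_domain_space[OF U order_refl] unfolding openin_D_topology
    by (blast, simp)
  moreover from \<open>A \<subseteq> U\<close> have "{u \<in> U. restrict (\<lambda>v. v) U u \<in> A} = A"
    by auto
  ultimately show "A \<subseteq> U \<and> openin (Euclidean_space n) A" by simp
next
  assume "A \<subseteq> U \<and> openin (Euclidean_space n) A"
  then show "openin (D_topology (domain_space n U)) A"
    using openin_plot_domain_space_preimage[OF _ U] by (auto simp: openin_D_topology)
qed

section \<open>Local lifts as local sections of the pullback\<close>

text \<open>Applied to a plot \<open>F\<close> with values in \<open>V\<close>, the section has the
  components \<open>F\<close> and \<open>L\<close> after \<open>F\<close>. The latter is a plot of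
  \<open>X\<close> by (D2), and the lifting equation places the pair in the pullback.\<close>

lemma smooth_map_lift_section:
  assumes X: "diffeological_space X" and L: "local_lift X f x n U P r V L"
  shows "smooth_map (subspace_diff (domain_space n U) V) (pullback_space (domain_space n U) P X f)
    (\<lambda>v. (v, L v))"
proof -
  have V: "V \<subseteq> U" and plot: "L \<in> plots X n V" and lift: "\<And>v. v \<in> V \<Longrightarrow> f (L v) = P v"
    using L by (auto simp: local_lift_def)
  have LX: "L v \<in> points X" if "v \<in> V" for v
    using plot_PiE[OF X plot] that by blast
  have "compose W (\<lambda>v. (v, L v)) F \<in> plots (pullback_space (domain_space n U) P X f) m W"
    if F: "F \<in> plots (domain_space n U) m W" and FV: "F ` W \<subseteq> V" for m W F
  proof -
    \<comment> \<open>Without extensionality the first component would agree with \<open>F\<close>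
      only on \<open>W\<close>, not as a function.\<close>
    have "F \<in> extensional W"
      using F by (simp add: domain_space_def)
    then have "compose W fst (compose W (\<lambda>v. (v, L v)) F) = F"
      by (auto simp: compose_def extensional_def)
    moreover have "compose W snd (compose W (\<lambda>v. (v, L v)) F) = compose W L F"
      by (auto simp: compose_def)
    moreover have "compose W L F \<in> plots X m W"
      by (rule plot_compose[OF X plot plots_domain_space_mono[OF F FV]])
    moreover have "compose W (\<lambda>v. (v, L v)) F ` W \<subseteq> points (pullback_space (domain_space n U) P X f)"
      using FV V LX lift by (auto simp: points_pullback_space compose_def image_subset_iff)
    ultimately show ?thesis
      using F by (simp add: plots_pullback_space)
  qed
  then show ?thesis
    using V LX lift by (auto simp: smooth_map_def points_pullback_space)
qed

text \<open>Applying the section to the inclusion plot of \<open>A\<close> exhibits its second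
  component as a plot of \<open>X\<close>. The values of \<open>\<sigma>\<close> lie in the
  pullback, and \<open>\<sigma> v\<close> has first component \<open>v\<close>; together these give
  the lifting equation.\<close>

lemma local_lift_of_section:
  assumes X: "diffeological_space X" and U: "openin (Euclidean_space n) U"
    and A: "openin (D_topology (domain_space n U)) A"
    and \<sigma>: "smooth_map (subspace_diff (domain_space n U) A) (pullback_space (domain_space n U) P X f) \<sigma>"
    and right_inv: "\<forall>y\<in>A. fst (\<sigma> y) = y" and rx: "(r, x) \<in> \<sigma> ` A"
  shows "local_lift X f x n U P r A (restrict (\<lambda>v. snd (\<sigma> v)) A)"
proof -
  have oA: "openin (Euclidean_space n) A" and AU: "A \<subseteq> U"
    using A openin_D_topology_domain_space[OF U] by auto
  have "compose A \<sigma> (restrict (\<lambda>v. v) A) \<in> plots (pullback_space (domain_space n U) P X f) n A"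
    using \<sigma> restrict_id_in_plots_domain_space[OF oA AU] unfolding smooth_map_def by auto
  then have "compose A snd (compose A \<sigma> (restrict (\<lambda>v. v) A)) \<in> plots X n A"
    by (simp add: plots_pullback_space)
  moreover have "compose A snd (compose A \<sigma> (restrict (\<lambda>v. v) A)) = restrict (\<lambda>v. snd (\<sigma> v)) A"
    by (auto simp: compose_def)
  moreover have "f (snd (\<sigma> v)) = P v" if "v \<in> A" for v
  proof -
    have "\<sigma> v \<in> points (pullback_space (domain_space n U) P X f)"
      using \<sigma> AU that unfolding smooth_map_def by auto
    then show ?thesis
      using right_inv that by (auto simp: points_pullback_space split: prod.splits)
  qed
  \<comment> \<open>A point of \<open>A\<close> sent to \<open>(r, x)\<close> equals the first
    component of its image, hence is \<open>r\<close> itself.\<close>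
  moreover have "r \<in> A" "\<sigma> r = (r, x)"
    using rx right_inv by (metis fst_conv imageE)+
  ultimately show ?thesis
    using oA AU by (simp add: local_lift_def)
qed

text \<open>The section, composed with the inclusion of \<open>V\<close>, is a plot of the pullback,
  so D-openness of \<open>A\<close> can be tested on it.\<close>

lemma openin_lift_preimage:
  assumes X: "diffeological_space X" and L: "local_lift X f x n U P r V L"
    and A: "openin (D_topology (pullback_space (domain_space n U) P X f)) A"
  shows "openin (Euclidean_space n) {v \<in> V. (v, L v) \<in> A}"
proof -
  have V: "openin (Euclidean_space n) V" "V \<subseteq> U"
    using L by (auto simp: local_lift_def)
  have "compose V (\<lambda>v. (v, L v)) (restrict (\<lambda>v. v) V) \<in> plots (pullback_space (domain_space n U) P X f) n V"
    using smooth_map_lift_section[OF X L] restrict_id_in_plots_domain_space[OF V]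
    unfolding smooth_map_def by auto
  then have "openin (Euclidean_space n) {v \<in> V. compose V (\<lambda>v. (v, L v)) (restrict (\<lambda>v. v) V) v \<in> A}"
    using A unfolding openin_D_topology by blast
  moreover have "{v \<in> V. compose V (\<lambda>v. (v, L v)) (restrict (\<lambda>v. v) V) v \<in> A} = {v \<in> V. (v, L v) \<in> A}"
    by (auto simp: compose_def)
  ultimately show ?thesis by simp
qed

text \<open>Near \<open>r\<close> the points \<open>(w, L w)\<close> and \<open>(w, L' w)\<close>
  both lie in \<open>A\<close> and have the same first component.\<close>

lemma same_germ_if_inj_on_fst:
  assumes X: "diffeological_space X"
    and A: "openin (D_topology (pullback_space (domain_space n U) P X f)) A"
    and rx: "(r, x) \<in> A" and inj: "inj_on fst A"
    and L: "local_lift X f x n U P r V L" and L': "local_lift X f x n U P r V' L'"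
  shows "same_germ n r V L V' L'"
proof -
  let ?W = "{v \<in> V. (v, L v) \<in> A} \<inter> {v \<in> V'. (v, L' v) \<in> A}"
  have "openin (Euclidean_space n) ?W"
    using openin_lift_preimage[OF X L A] openin_lift_preimage[OF X L' A] by blast
  moreover have "r \<in> ?W"
    using L L' rx by (auto simp: local_lift_def)
  moreover have "\<forall>w\<in>?W. L w = L' w"
    using inj_onD[OF inj, of "(w, L w)" "(w, L' w)" for w] by auto
  moreover have "?W \<subseteq> V \<inter> V'"
    by auto
  ultimately show ?thesis
    unfolding same_germ_def by blast
qed

lemma lift_data_in_pullback:
  "lift_data X Y f x n U P r \<Longrightarrow> (r, x) \<in> points (pullback_space (domain_space n U) P X f)"
  by (auto simp: lift_data_def points_pullback_space)

section \<open>Submersions and existence of local lifts\<close>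

text \<open>Data \<open>(x, P, r)\<close> are the same as a plot \<open>P\<close> with a point
  \<open>(r, x)\<close> of its pullback, and local lifts for them correspond to local sections
  through that point.\<close>

lemma diffeological_submersion_iff_local_lifts:
  assumes X: "diffeological_space X" and Y: "diffeological_space Y" and f: "smooth_map X Y f"
  shows "diffeological_submersion X Y f \<longleftrightarrow>
    (\<forall>x n U P r. lift_data X Y f x n U P r \<longrightarrow> (\<exists>V L. local_lift X f x n U P r V L))"
proof (intro iffI allI impI)
  fix x n U P r
  assume S: "diffeological_submersion X Y f" and D: "lift_data X Y f x n U P r"
  then have P: "P \<in> plots Y n U"
    by (simp add: lift_data_def)
  then obtain A \<sigma> where "openin (D_topology (domain_space n U)) A"
    "smooth_map (subspace_diff (domain_space n U) A) (pullback_space (domain_space n U) P X f) \<sigma>"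
    "\<forall>y\<in>A. fst (\<sigma> y) = y" "(r, x) \<in> \<sigma> ` A"
    using S lift_data_in_pullback[OF D] unfolding diffeological_submersion_def submersion_def by blast
  then show "\<exists>V L. local_lift X f x n U P r V L"
    using local_lift_of_section[OF X plot_openin[OF Y P]] by blast
next
  assume lifts: "\<forall>x n U P r. lift_data X Y f x n U P r \<longrightarrow> (\<exists>V L. local_lift X f x n U P r V L)"
  have "\<exists>A \<sigma>. openin (D_topology (domain_space n U)) A \<and>
      smooth_map (subspace_diff (domain_space n U) A) (pullback_space (domain_space n U) P X f) \<sigma> \<and>
      (\<forall>y\<in>A. fst (\<sigma> y) = y) \<and> p \<in> \<sigma> ` A"
    if P: "P \<in> plots Y n U" and p: "p \<in> points (pullback_space (domain_space n U) P X f)" for n U P p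
  proof -
    obtain r x where rx: "p = (r, x)" "lift_data X Y f x n U P r"
      using P p by (auto simp: points_pullback_space lift_data_def)
    then obtain V L where L: "local_lift X f x n U P r V L"
      using lifts by blast
    then have "openin (D_topology (domain_space n U)) V"
      using openin_D_topology_domain_space[OF plot_openin[OF Y P]] by (simp add: local_lift_def)
    moreover have "p \<in> (\<lambda>v. (v, L v)) ` V"
      using L rx by (auto simp: local_lift_def)
    ultimately show ?thesis
      using smooth_map_lift_section[OF X L] by (intro exI[of _ V] exI[of _ "\<lambda>v. (v, L v)"]) simp
  qed
  then show "diffeological_submersion X Y f"
    using f smooth_map_fst_pullback_space unfolding diffeological_submersion_def submersion_def by blast
qed

section \<open>Immersions and uniqueness of local lifts\<close>

text \<open>The map \<open>\<rho>\<close> is a left inverse of \<open>fst\<close> on a D-open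
  neighbourhood of \<open>(r, x)\<close>, so \<open>fst\<close> is injective there.\<close>

lemma diffeological_immersion_same_germ:
  assumes X: "diffeological_space X" and f: "diffeological_immersion X Y f"
    and D: "lift_data X Y f x n U P r"
    and L: "local_lift X f x n U P r V L" and L': "local_lift X f x n U P r V' L'"
  shows "same_germ n r V L V' L'"
proof -
  have P: "P \<in> plots Y n U"
    using D by (simp add: lift_data_def)
  obtain A \<rho> where A: "openin (D_topology (pullback_space (domain_space n U) P X f)) A"
    "(r, x) \<in> A" and \<rho>: "\<forall>p\<in>A. \<rho> (fst p) = p"
    using bspec[OF bspec[OF spec[OF spec[OF conjunct2[OF f[unfolded diffeological_immersion_def]]]] P]
        lift_data_in_pullback[OF D]]
    by blast
  have "inj_on fst A"
    by (rule inj_on_inverseI[of _ \<rho>]) (use \<rho> in blast)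
  then show ?thesis
    using same_germ_if_inj_on_fst[OF X A _ L L'] by blast
qed

section \<open>Etale maps: existence and uniqueness of local lifts\<close>

lemma smooth_map_into_subspace_diff:
  "smooth_map X (subspace_diff Y A) f \<Longrightarrow> smooth_map X Y f"
  unfolding smooth_map_def by auto

text \<open>The inverse of a local diffeomorphism around \<open>x\<close>, regarded as a map into
  all of \<open>X\<close>, is a section through \<open>x\<close>. Smoothness of \<open>f\<close> is
  a separate assumption because \<open>etale\<close> only states the local condition.\<close>

lemma etale_imp_submersion:
  assumes "etale X Y f" "smooth_map X Y f"
  shows "submersion X Y f"
proof -
  have "\<exists>B \<sigma>. openin (D_topology Y) B \<and> smooth_map (subspace_diff Y B) X \<sigma> \<and>
      (\<forall>y\<in>B. f (\<sigma> y) = y) \<and> x \<in> \<sigma> ` B" if x: "x \<in> points X" for x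
  proof -
    obtain A B where AB: "openin (D_topology X) A" "x \<in> A" "openin (D_topology Y) B" "f x \<in> B"
      and d: "diffeomorphism (subspace_diff X A) (subspace_diff Y B) f"
      using assms x unfolding etale_def by blast
    have sub: "B \<subseteq> points Y"
      using AB by (auto simp: openin_D_topology)
    let ?\<sigma> = "inv_into (points X \<inter> A) f"
    have bij: "bij_betw f (points X \<inter> A) B"
      using d sub by (simp add: diffeomorphism_def Int_absorb1)
    have "smooth_map (subspace_diff Y B) X ?\<sigma>"
      using d smooth_map_into_subspace_diff by (simp add: diffeomorphism_def) blast
    moreover have "\<forall>y\<in>B. f (?\<sigma> y) = y"
      using bij by (simp add: bij_betw_inv_into_right)
    moreover have "x = ?\<sigma> (f x)"
      using bij x AB by (simp add: bij_betw_inv_into_left)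
    ultimately show ?thesis
      using AB by blast
  qed
  then show ?thesis
    using assms(2) by (auto simp: submersion_def)
qed

lemma diffeological_etale_imp_submersion:
  "diffeological_etale X Y f \<Longrightarrow> diffeological_submersion X Y f"
  unfolding diffeological_etale_def diffeological_submersion_def
  using etale_imp_submersion smooth_map_fst_pullback_space by blast

lemma diffeological_etale_same_germ:
  assumes X: "diffeological_space X" and f: "diffeological_etale X Y f"
    and D: "lift_data X Y f x n U P r"
    and L: "local_lift X f x n U P r V L" and L': "local_lift X f x n U P r V' L'"
  shows "same_germ n r V L V' L'"
proof -
  let ?X = "pullback_space (domain_space n U) P X f"
  have "P \<in> plots Y n U"
    using D by (simp add: lift_data_def)
  then obtain A B where A: "openin (D_topology ?X) A" "(r, x) \<in> A"
    and d: "diffeomorphism (subspace_diff ?X A) (subspace_diff (domain_space n U) B) fst"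
    using f lift_data_in_pullback[OF D] unfolding diffeological_etale_def etale_def by blast
  have "points ?X \<inter> A = A"
    using A by (auto simp: openin_D_topology)
  then have "inj_on fst A"
    using d by (simp add: diffeomorphism_def bij_betw_def)
  then show ?thesis
    using same_germ_if_inj_on_fst[OF X A _ L L'] by blast
qed

text \<open>Uniqueness is assumed for all data, not only those over \<open>P\<close>: it gets
  applied to the composites of \<open>P\<close> with first components of plots of the pullback,
  whose domains may have another dimension \<open>m\<close>.\<close>

lemma openin_D_topology_lift_image:
  assumes X: "diffeological_space X" and Y: "diffeological_space Y"
    and unique: "\<And>x n U P r V L V' L'. lift_data X Y f x n U P r \<Longrightarrow>
      local_lift X f x n U P r V L \<Longrightarrow> local_lift X f x n U P r V' L' \<Longrightarrow> same_germ n r V L V' L'"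
    and P: "P \<in> plots Y n U" and L: "local_lift X f x n U P r V L"
  shows "openin (D_topology (pullback_space (domain_space n U) P X f)) ((\<lambda>v. (v, L v)) ` V)"
  unfolding openin_D_topology
proof (intro conjI allI ballI)
  let ?X = "pullback_space (domain_space n U) P X f"
  have V: "openin (Euclidean_space n) V" "V \<subseteq> U" and plot: "L \<in> plots X n V"
    and lift: "\<And>v. v \<in> V \<Longrightarrow> f (L v) = P v"
    using L by (auto simp: local_lift_def)
  show "(\<lambda>v. (v, L v)) ` V \<subseteq> points ?X"
    using smooth_map_lift_section[OF X L] V(2) by (auto simp: smooth_map_def)
  fix m W Q
  assume Q: "Q \<in> plots ?X m W"
  define F where "F = compose W fst Q"
  define G where "G = compose W snd Q"
  have F: "F \<in> plots (domain_space n U) m W" and G: "G \<in> plots X m W"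
    using Q by (auto simp: plots_pullback_space F_def G_def)
  have Qw: "Q w = (F w, G w)" "F w \<in> U" "G w \<in> points X" "P (F w) = f (G w)" if "w \<in> W" for w
    using Q that by (auto simp: plots_pullback_space points_pullback_space F_def G_def compose_def
        image_subset_iff case_prod_beta)
  let ?S = "{w \<in> W. Q w \<in> (\<lambda>v. (v, L v)) ` V}"
  \<comment> \<open>If \<open>Q w\<close> is \<open>(v, L v)\<close>, then \<open>v\<close> must be
    \<open>F w\<close>.\<close>
  have S: "?S = {w \<in> W. F w \<in> V \<and> G w = L (F w)}"
    using Qw(1) by auto
  let ?V' = "{w \<in> W. F w \<in> V}"
  have V': "openin (Euclidean_space m) ?V'"
    by (rule openin_plot_domain_space_preimage[OF F plot_openin[OF Y P] V(1)])
  have W: "openin (Euclidean_space m) W"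
    by (rule plot_openin[OF X G])
  have "\<exists>T. openin (Euclidean_space m) T \<and> w \<in> T \<and> T \<subseteq> ?S" if "w \<in> ?S" for w
  proof -
    have w: "w \<in> W" "F w \<in> V" "G w = L (F w)"
      using that S by auto
    \<comment> \<open>The data are moved to the base point \<open>w\<close> and the plot
      \<open>P\<close> after \<open>F\<close>, with \<open>G w\<close> as the prescribed
      value.\<close>
    have D: "lift_data X Y f (G w) m W (compose W P F) w"
      using w(1) Qw[OF w(1)] plot_compose[OF Y P F] by (simp add: lift_data_def compose_def)
    have 1: "local_lift X f (G w) m W (compose W P F) w W G"
      using W w G Qw by (simp add: local_lift_def compose_def)
    \<comment> \<open>Since \<open>L\<close> is defined on \<open>V\<close> only, \<open>F\<close>
      is cut down to the preimage of \<open>V\<close> before being composed with it.\<close>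
    have F': "restrict F ?V' \<in> plots (domain_space n V) m ?V'"
      by (rule plots_domain_space_mono[OF restrict_in_plots_domain_space[OF F V']]) auto
    have 2: "local_lift X f (G w) m W (compose W P F) w ?V' (compose ?V' L (restrict F ?V'))"
      using V' w lift plot_compose[OF X plot F'] by (auto simp: local_lift_def compose_def)
    obtain T where "openin (Euclidean_space m) T" "w \<in> T" "T \<subseteq> W \<inter> ?V'"
      "\<forall>t\<in>T. G t = compose ?V' L (restrict F ?V') t"
      using unique[OF D 1 2] unfolding same_germ_def by blast
    then show ?thesis
      unfolding S by (intro exI[of _ T]) (auto simp: compose_def)
  qed
  then show "openin (Euclidean_space m) ?S"
    by (subst openin_subopen) blast
qed

text \<open>Existence provides a lift, and uniqueness makes the image of its section D-open. On this
  image \<open>fst\<close> is a diffeomorphism onto the domain \<open>V\<close> of the lift, with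
  the section as its inverse.\<close>

lemma diffeological_etale_if_unique_local_lifts:
  assumes X: "diffeological_space X" and Y: "diffeological_space Y" and f: "smooth_map X Y f"
    and ex: "\<And>x n U P r. lift_data X Y f x n U P r \<Longrightarrow> \<exists>V L. local_lift X f x n U P r V L"
    and unique: "\<And>x n U P r V L V' L'. lift_data X Y f x n U P r \<Longrightarrow>
      local_lift X f x n U P r V L \<Longrightarrow> local_lift X f x n U P r V' L' \<Longrightarrow> same_germ n r V L V' L'"
  shows "diffeological_etale X Y f"
proof -
  have "\<exists>A B. openin (D_topology (pullback_space (domain_space n U) P X f)) A \<and> p \<in> A \<and>
      openin (D_topology (domain_space n U)) B \<and> fst p \<in> B \<and>
      diffeomorphism (subspace_diff (pullback_space (domain_space n U) P X f) A)
        (subspace_diff (domain_space n U) B) fst"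
    if P: "P \<in> plots Y n U" and p: "p \<in> points (pullback_space (domain_space n U) P X f)" for n U P p
  proof -
    let ?X = "pullback_space (domain_space n U) P X f"
    obtain r x where rx: "p = (r, x)" "lift_data X Y f x n U P r"
      using P p by (auto simp: points_pullback_space lift_data_def)
    then obtain V L where L: "local_lift X f x n U P r V L"
      using ex by blast
    let ?\<sigma> = "\<lambda>v. (v, L v)"
    let ?A = "?\<sigma> ` V"
    have A: "openin (D_topology ?X) ?A"
      by (rule openin_D_topology_lift_image[OF X Y unique P L])
    have V: "openin (D_topology (domain_space n U)) V" and VU: "V \<subseteq> U"
      using L openin_D_topology_domain_space[OF plot_openin[OF Y P]] by (auto simp: local_lift_def)
    have pA: "p \<in> ?A" "fst p \<in> V"
      using L rx by (auto simp: local_lift_def)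
    have pts: "points ?X \<inter> ?A = ?A" "U \<inter> V = V"
      using A VU by (auto simp: openin_D_topology)
    have bij: "bij_betw fst ?A V"
      by (auto simp: bij_betw_def inj_on_def image_image)
    have "smooth_map (subspace_diff ?X ?A) (subspace_diff (domain_space n U) V) fst"
      using smooth_map_fst_pullback_space[of "domain_space n U" P X f] pts VU
      by (fastforce simp: smooth_map_def compose_def)
    moreover have "smooth_map (subspace_diff (domain_space n U) V) (subspace_diff ?X ?A) (inv_into ?A fst)"
    proof -
      \<comment> \<open>The two maps are compared on \<open>V\<close> only, which suffices because
        plots of the subspace take their values there.\<close>
      have inv: "inv_into ?A fst v = ?\<sigma> v" if "v \<in> V" for v
        using bij that by (intro inv_into_f_eq) (auto simp: bij_betw_def)
      have "compose W (inv_into ?A fst) F = compose W ?\<sigma> F" if "F ` W \<subseteq> V" for W :: "vec set" and F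
        using inv that by (auto simp: compose_def fun_eq_iff)
      then show ?thesis
        using smooth_map_lift_section[OF X L] inv pts
        by (auto simp: smooth_map_def) (auto simp: compose_def)
    qed
    ultimately have "diffeomorphism (subspace_diff ?X ?A) (subspace_diff (domain_space n U) V) fst"
      using bij by (simp add: diffeomorphism_def pts)
    then show ?thesis
      using A V pA by blast
  qed
  then have "etale (pullback_space (domain_space n U) P X f) (domain_space n U) fst"
    if "P \<in> plots Y n U" for n U P
    using that unfolding etale_def by (auto simp: points_pullback_space)
  then show ?thesis
    using f by (simp add: diffeological_etale_def)
qed

theorem propositionA:
  fixes X :: "'a diff_space" and Y :: "'b diff_space" and f :: "'a \<Rightarrow> 'b"
  assumes "diffeological_space X" and "diffeological_space Y" and "smooth_map X Y f"
  shows "(diffeological_submersion X Y f \<longleftrightarrow>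
            (\<forall>x n U P r. lift_data X Y f x n U P r \<longrightarrow> (\<exists>V L. local_lift X f x n U P r V L)))
       \<and> (diffeological_immersion X Y f \<longrightarrow>
            (\<forall>x n U P r. lift_data X Y f x n U P r \<longrightarrow>
               (\<forall>V L V' L'. local_lift X f x n U P r V L \<and> local_lift X f x n U P r V' L'
                  \<longrightarrow> same_germ n r V L V' L')))
       \<and> (diffeological_etale X Y f \<longleftrightarrow>
            (\<forall>x n U P r. lift_data X Y f x n U P r \<longrightarrow>
               (\<exists>V L. local_lift X f x n U P r V L) \<and>
               (\<forall>V L V' L'. local_lift X f x n U P r V L \<and> local_lift X f x n U P r V' L'
                  \<longrightarrow> same_germ n r V L V' L')))"
proof (intro conjI, goal_cases)
  case 1
  show ?case
    by (rule diffeological_submersion_iff_local_lifts[OF assms])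
next
  case 2
  show ?case
    using diffeological_immersion_same_germ[OF assms(1)] by blast
next
  case 3
  show ?case
  proof (intro iffI allI impI conjI; (elim conjE)?)
    assume E: "diffeological_etale X Y f"
    fix x n U P r assume D: "lift_data X Y f x n U P r"
    show "\<exists>V L. local_lift X f x n U P r V L"
      using diffeological_etale_imp_submersion[OF E] D
      by (simp add: diffeological_submersion_iff_local_lifts[OF assms])
    show "same_germ n r V L V' L'"
      if "local_lift X f x n U P r V L" "local_lift X f x n U P r V' L'" for V L V' L'
      using diffeological_etale_same_germ[OF assms(1) E D that] .
  next
    assume "\<forall>x n U P r. lift_data X Y f x n U P r \<longrightarrow>
               (\<exists>V L. local_lift X f x n U P r V L) \<and>
               (\<forall>V L V' L'. local_lift X f x n U P r V L \<and> local_lift X f x n U P r V' L'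
                  \<longrightarrow> same_germ n r V L V' L')"
    then show "diffeological_etale X Y f"
      by (intro diffeological_etale_if_unique_local_lifts[OF assms]) blast+
  qed
qed

end
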